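(* Let $A\in\mathbb{R}^{m\times n}$, let $M\in\mathbb{R}^{n\times n}$ be symmetric positive semidefinite, let $G\in\mathbb{R}^{m\times m}$ be symmetric positive definite, and let $b\in\mathbb{R}^m$ be nonzero. Run the gGKB process for $(A,M,G)$ with starting vector $b$ (described in the context), and let $k\ge1$ be such that $\alpha_i\beta_i\ne0$ for $1\le i\le k$. Then each generated $v_i$ belongs to $\mathcal{R}(M)$. The vectors $\{v_i\}_{i=1}^k$ form an $M$-orthonormal basis of the Krylov subspace $$\mathcal{K}_k(M^{\dag}A^{\top}GA,\,M^{\dag}A^{\top}Gb)=\mathrm{span}\{(M^{\dag}A^{\top}GA)^iM^{\dag}A^{\top}Gb\}_{i=0}^{k-1},$$ and $\{u_i\}_{i=1}^k$ form a $G$-orthonormal basis of the Krylov subspace $$\mathcal{K}_k(AM^{\dag}A^{\top}G,\,b)=\mathrm{span}\{(AM^{\dag}A^{\top}G)^ib\}_{i=0}^{k-1}.$$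
   Context: $\mathcal{R}(\cdot)$ is the column space, $M^{\dag}$ the Moore-Penrose pseudoinverse, $\|v\|_M=(v^{\top}Mv)^{1/2}$ (a norm on $\mathcal{R}(M)$), $\|u\|_G=(u^{\top}Gu)^{1/2}$. $M$-orthonormal means $v_i^{\top}Mv_j=\delta_{ij}$; $G$-orthonormal means $u_i^{\top}Gu_j=\delta_{ij}$. gGKB process (generalized Golub-Kahan bidiagonalization): $v_0=\mathbf{0}$, $\beta_1u_1=b$, and for $i\ge1$ $$\alpha_iv_i=M^{\dag}A^{\top}Gu_i-\beta_iv_{i-1},\qquad \beta_{i+1}u_{i+1}=Av_i-\alpha_iu_i,$$ where $\alpha_i\ge0,\beta_i\ge0$ are chosen so that $\|v_i\|_M=\|u_i\|_G=1$, i.e. $\alpha_i$ (resp. $\beta_{i+1}$) is the $M$-norm (resp. $G$-norm) of the right-hand side and the vector is obtained by normalizing; the process terminates when some $\alpha_i$ or $\beta_i$ is zero. *)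

theory Defs
  imports "HOL-Analysis.Analysis"
begin

definition symmetric_matrix :: "real^'n^'n \<Rightarrow> bool" where
  "symmetric_matrix M \<longleftrightarrow> transpose M = M"

definition pos_semidef :: "real^'n^'n \<Rightarrow> bool" where
  "pos_semidef M \<longleftrightarrow> symmetric_matrix M \<and> (\<forall>x. 0 \<le> x \<bullet> (M *v x))"

definition pos_def :: "real^'n^'n \<Rightarrow> bool" where
  "pos_def M \<longleftrightarrow> symmetric_matrix M \<and> (\<forall>x. x \<noteq> 0 \<longrightarrow> 0 < x \<bullet> (M *v x))"

definition column_space :: "real^'n^'m \<Rightarrow> (real^'m) set" where
  "column_space A = span (columns A)"

text \<open>For positive semidefinite \<open>M\<close> this is in general a norm only on \<open>column_space M\<close>.\<close>

definition wnorm :: "real^'n^'n \<Rightarrow> real^'n \<Rightarrow> real" where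
  "wnorm M x = sqrt (x \<bullet> (M *v x))"

definition penrose_conditions :: "real^'n^'m \<Rightarrow> real^'m^'n \<Rightarrow> bool" where
  "penrose_conditions A X \<longleftrightarrow>
     A ** X ** A = A \<and> X ** A ** X = X \<and>
     symmetric_matrix (A ** X) \<and> symmetric_matrix (X ** A)"

definition pinv :: "real^'n^'m \<Rightarrow> real^'m^'n" where
  "pinv A = (THE X. penrose_conditions A X)"

text \<open>The description operator in the definition of the pseudoinverse is justified by
  existence and uniqueness.\<close>

lemma inner_matrix_vector:
  fixes A :: "real^'n^'m"
  shows "(A *v x) \<bullet> y = x \<bullet> (transpose A *v y)"
  by (metis dot_lmul_matrix inner_commute transpose_matrix_vector)

lemma symmetric_matrixI:
  fixes B :: "real^'n^'n"
  assumes "\<And>x y. (B *v x) \<bullet> y = x \<bullet> (B *v y)"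
  shows "symmetric_matrix B"
proof -
  have "transpose B *v y = B *v y" for y
    using assms inner_matrix_vector[of B] by (metis vector_eq_ldot)
  then show ?thesis
    unfolding symmetric_matrix_def by (simp add: matrix_eq)
qed

lemma penrose_exists:
  fixes A :: "real^'n^'m"
  shows "\<exists>X. penrose_conditions A X"
proof -
  note transpose_matrix_vector [simp del]
  let ?T = "transpose A"
  have dec: "\<exists>x z. y = B *v x + z \<and> transpose B *v z = 0"
    for B :: "real^'p^'q" and y
  proof -
    obtain p z where p: "p \<in> span (range ((*v) B))" and
      z: "\<And>w. w \<in> span (range ((*v) B)) \<Longrightarrow> orthogonal z w" and y: "y = p + z"
      using orthogonal_subspace_decomp_exists by blast
    have "span (range ((*v) B)) = range ((*v) B)"
      by (simp add: linear_subspace_image span_eq_iff)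
    with p obtain x where x: "p = B *v x" by auto
    have "(transpose B *v z) \<bullet> w = 0" for w
      using z[of "B *v w"] inner_matrix_vector[of B w z]
      by (simp add: span_base orthogonal_def inner_commute)
    then have "transpose B *v z = 0"
      by (metis inner_eq_zero_iff)
    with y x show ?thesis by blast
  qed
  have ker: "A *v x = 0" if "?T *v (A *v x) = 0" for x
    using inner_matrix_vector[of A x "A *v x"] that by simp
  have ex: "\<exists>w. ?T *v (y - A *v (?T *v w)) = 0" for y
  proof -
    obtain x z where 1: "y = A *v x + z" "?T *v z = 0" using dec by blast
    obtain w n where 2: "x = ?T *v w + n" "A *v n = 0" using dec[of x ?T] by auto
    have "y - A *v (?T *v w) = z"
      using 1 2 by (simp add: matrix_vector_right_distrib)
    with 1 show ?thesis by metis
  qed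
  then obtain g where g: "\<And>y. ?T *v (y - A *v (?T *v g y)) = 0" by metis
  define f where "f y = ?T *v g y" for y
  have f: "?T *v (A *v f y) = ?T *v y" for y
    using g[of y] by (simp add: f_def matrix_vector_mult_diff_distrib)
  have ortho: "f y \<bullet> n = 0" if "A *v n = 0" for y n
    using inner_matrix_vector[of ?T "g y" n] that by (simp add: f_def)
  have uniq: "f y = ?T *v w" if "?T *v (A *v (?T *v w)) = ?T *v y" for y w
  proof -
    have "?T *v (A *v (f y - ?T *v w)) = 0"
      using that f by (simp add: matrix_vector_mult_diff_distrib)
    then have "A *v (f y - ?T *v w) = 0" by (rule ker)
    moreover have "f y - ?T *v w = ?T *v (g y - w)"
      by (simp add: f_def matrix_vector_mult_diff_distrib)
    ultimately have "(f y - ?T *v w) \<bullet> (f y - ?T *v w) = 0"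
      using inner_matrix_vector[of ?T "g y - w" "f y - ?T *v w"] by simp
    then show ?thesis by simp
  qed
  have lin: "linear f"
  proof (rule linearI)
    show "f (x + y) = f x + f y" for x y
      using uniq[of "g x + g y" "x + y"] f
      by (simp add: f_def matrix_vector_right_distrib)
    show "f (c *\<^sub>R x) = c *\<^sub>R f x" for c x
      using uniq[of "c *\<^sub>R g x" "c *\<^sub>R x"] f
      by (simp add: f_def matrix_vector_mult_scaleR)
  qed
  let ?X = "matrix f"
  have X: "?X *v y = f y" for y using lin by (simp add: matrix_works)
  have AfA: "A *v f (A *v v) = A *v v" for v
    using ker[of "f (A *v v) - v"] f[of "A *v v"]
    by (simp add: matrix_vector_mult_diff_distrib)
  have "A ** ?X ** A = A"
    by (simp add: matrix_eq X AfA flip: matrix_vector_mul_assoc)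
  moreover have "f (A *v f y) = f y" for y
    using uniq[of "g y" "A *v f y"] by (simp add: f_def)
  then have "?X ** A ** ?X = ?X"
    by (simp add: matrix_eq X flip: matrix_vector_mul_assoc)
  moreover have AX: "(A *v f y) \<bullet> z = (A *v f y) \<bullet> (A *v f z)" for y z
    using f by (simp add: inner_matrix_vector)
  have "symmetric_matrix (A ** ?X)"
    by (rule symmetric_matrixI) (metis AX X inner_commute matrix_vector_mul_assoc)
  moreover have XA: "f (A *v x) \<bullet> y = f (A *v x) \<bullet> f (A *v y)" for x y
    using ortho[of "y - f (A *v y)"] AfA
    by (simp add: matrix_vector_mult_diff_distrib inner_diff_right)
  have "symmetric_matrix (?X ** A)"
    by (rule symmetric_matrixI) (metis XA X inner_commute matrix_vector_mul_assoc)
  ultimately show ?thesis unfolding penrose_conditions_def by blast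
qed

lemma penrose_unique:
  fixes A :: "real^'n^'m"
  assumes X: "penrose_conditions A X" and Y: "penrose_conditions A Y"
  shows "X = Y"
proof -
  note defs = penrose_conditions_def symmetric_matrix_def
  have AX: "A ** X = A ** Y"
  proof -
    have "A ** X = transpose ((A ** Y) ** (A ** X))"
      using X Y unfolding defs by (metis matrix_mul_assoc)
    also have "\<dots> = (A ** X) ** (A ** Y)"
      using X Y unfolding defs by (simp add: matrix_transpose_mul)
    also have "\<dots> = A ** Y"
      using X unfolding defs by (simp add: matrix_mul_assoc)
    finally show ?thesis .
  qed
  have XA: "X ** A = Y ** A"
  proof -
    have "X ** A = transpose ((X ** A) ** (Y ** A))"
      using X Y unfolding defs by (metis matrix_mul_assoc)
    also have "\<dots> = (Y ** A) ** (X ** A)"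
      using X Y unfolding defs by (simp add: matrix_transpose_mul)
    also have "\<dots> = Y ** A"
      using X unfolding defs by (metis matrix_mul_assoc)
    finally show ?thesis .
  qed
  show ?thesis
    using X Y AX XA unfolding penrose_conditions_def by (metis matrix_mul_assoc)
qed

lemma pinv_penrose: "penrose_conditions A (pinv A)"
  unfolding pinv_def using penrose_exists penrose_unique by (metis theI)

definition krylov :: "nat \<Rightarrow> real^'n^'n \<Rightarrow> real^'n \<Rightarrow> (real^'n) set" where
  "krylov k B c = span {((*v) B ^^ i) c | i. i < k}"

definition wt_orthonormal :: "real^'n^'n \<Rightarrow> nat \<Rightarrow> (nat \<Rightarrow> real^'n) \<Rightarrow> bool" where
  "wt_orthonormal M k w \<longleftrightarrow>
     (\<forall>i\<in>{1..k}. \<forall>j\<in>{1..k}. w i \<bullet> (M *v w j) = (if i = j then 1 else 0))"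

definition wt_orthonormal_basis ::
  "real^'n^'n \<Rightarrow> nat \<Rightarrow> (nat \<Rightarrow> real^'n) \<Rightarrow> (real^'n) set \<Rightarrow> bool" where
  "wt_orthonormal_basis M k w S \<longleftrightarrow>
     wt_orthonormal M k w \<and>
     inj_on w {1..k} \<and> independent (w ` {1..k}) \<and> span (w ` {1..k}) = S"

text \<open>The gGKB process as total sequences indexed as in the recurrences, from 1. The values
  \<open>u\<^sub>0\<close>, \<open>\<alpha>\<^sub>0\<close>, \<open>\<beta>\<^sub>0\<close> are dummies. Since division by zero yields zero, the sequences continue
  with meaningless values after termination; only the indices singled out by
  \<open>gGKB_runs\<close> below belong to the process.\<close>

function
  gGKB_beta :: "real^'n^'m \<Rightarrow> real^'n^'n \<Rightarrow> real^'m^'m \<Rightarrow> real^'m \<Rightarrow> nat \<Rightarrow> real" and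
  gGKB_u :: "real^'n^'m \<Rightarrow> real^'n^'n \<Rightarrow> real^'m^'m \<Rightarrow> real^'m \<Rightarrow> nat \<Rightarrow> real^'m" and
  gGKB_alpha :: "real^'n^'m \<Rightarrow> real^'n^'n \<Rightarrow> real^'m^'m \<Rightarrow> real^'m \<Rightarrow> nat \<Rightarrow> real" and
  gGKB_v :: "real^'n^'m \<Rightarrow> real^'n^'n \<Rightarrow> real^'m^'m \<Rightarrow> real^'m \<Rightarrow> nat \<Rightarrow> real^'n"
where
  "gGKB_beta A M G b 0 = 0"
| "gGKB_beta A M G b (Suc 0) = wnorm G b"
| "gGKB_beta A M G b (Suc (Suc i)) =
     wnorm G (A *v gGKB_v A M G b (Suc i)
              - gGKB_alpha A M G b (Suc i) *\<^sub>R gGKB_u A M G b (Suc i))"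
| "gGKB_u A M G b 0 = 0"
| "gGKB_u A M G b (Suc 0) = b /\<^sub>R gGKB_beta A M G b (Suc 0)"
| "gGKB_u A M G b (Suc (Suc i)) =
     (A *v gGKB_v A M G b (Suc i)
      - gGKB_alpha A M G b (Suc i) *\<^sub>R gGKB_u A M G b (Suc i))
     /\<^sub>R gGKB_beta A M G b (Suc (Suc i))"
| "gGKB_alpha A M G b 0 = 0"
| "gGKB_alpha A M G b (Suc i) =
     wnorm M ((pinv M ** transpose A ** G) *v gGKB_u A M G b (Suc i)
              - gGKB_beta A M G b (Suc i) *\<^sub>R gGKB_v A M G b i)"
| "gGKB_v A M G b 0 = 0"
| "gGKB_v A M G b (Suc i) =
     ((pinv M ** transpose A ** G) *v gGKB_u A M G b (Suc i)
      - gGKB_beta A M G b (Suc i) *\<^sub>R gGKB_v A M G b i)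
     /\<^sub>R gGKB_alpha A M G b (Suc i)"
  by pat_completeness auto
termination
  by (relation "Wellfounded.measure (\<lambda>x. case x of
        Inl (Inl (A, M, G, b, i)) \<Rightarrow> 4 * i
      | Inl (Inr (A, M, G, b, i)) \<Rightarrow> 4 * i + 1
      | Inr (Inl (A, M, G, b, i)) \<Rightarrow> 4 * i + 2
      | Inr (Inr (A, M, G, b, i)) \<Rightarrow> 4 * i + 3)") auto

definition gGKB_runs ::
  "real^'n^'m \<Rightarrow> real^'n^'n \<Rightarrow> real^'m^'m \<Rightarrow> real^'m \<Rightarrow> nat \<Rightarrow> bool" where
  "gGKB_runs A M G b k \<longleftrightarrow>
     (\<forall>i\<in>{1..k}. gGKB_alpha A M G b i * gGKB_beta A M G b i \<noteq> 0)"

end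

theory Submission
  imports Defs
begin

text \<open>
  On \<open>column_space M\<close> the matrix \<open>Q = pinv M ** transpose A ** G\<close> is the adjoint of \<open>A\<close> with
  respect to the inner products given by \<open>M\<close> and \<open>G\<close>. Hence the three-term recurrences yield
  orthonormality by simultaneous induction, exactly as for the classical Golub-Kahan process.
  The iterates lie in the Krylov subspaces, of dimension at most \<open>k\<close>, and \<open>k\<close> orthonormal vectors
  are independent, so they span them.
\<close>

section \<open>Symmetric matrices and the pseudoinverse\<close>

lemma symmetric_matrix_inner:
  assumes "symmetric_matrix M"
  shows "x \<bullet> (M *v y) = y \<bullet> (M *v x)"
  using assms unfolding symmetric_matrix_def
  by (metis inner_commute inner_matrix_vector)

lemma pos_def_imp_pos_semidef: "pos_def G \<Longrightarrow> pos_semidef G"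
  unfolding pos_def_def pos_semidef_def
  by (metis inner_zero_left less_eq_real_def order_refl)

text \<open>Transposing the four Penrose conditions for a symmetric \<open>M\<close> gives the same
  conditions for the transpose of \<open>pinv M\<close>, so uniqueness of the pseudoinverse
  applies.\<close>

lemma symmetric_pinv:
  assumes "symmetric_matrix M"
  shows "symmetric_matrix (pinv M)"
proof -
  let ?P = "pinv M"
  note P = pinv_penrose[of M, unfolded penrose_conditions_def symmetric_matrix_def]
  have M: "transpose M = M"
    using assms by (simp add: symmetric_matrix_def)
  have "M ** transpose ?P = ?P ** M" "transpose ?P ** M = M ** ?P"
    using P M by (metis matrix_transpose_mul)+
  moreover have "transpose ?P ** M ** transpose ?P = transpose ?P"
    using P M by (metis matrix_transpose_mul matrix_mul_assoc)
  ultimately have "penrose_conditions M (transpose ?P)"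
    using P M unfolding penrose_conditions_def symmetric_matrix_def
    by (metis matrix_mul_assoc)
  then show ?thesis
    unfolding symmetric_matrix_def using penrose_unique pinv_penrose by blast
qed

lemma symmetric_pinv_commute:
  assumes "symmetric_matrix M"
  shows "pinv M ** M = M ** pinv M"
  using assms symmetric_pinv[OF assms] pinv_penrose[of M]
  unfolding penrose_conditions_def symmetric_matrix_def
  by (metis matrix_transpose_mul)

text \<open>The fixed-point equation is the algebraic form of membership in the column space that
  the iterates satisfy. Since \<open>pinv M\<close> and \<open>M\<close> commute, it exhibits
  \<open>x\<close> as an image under \<open>M\<close>.\<close>

lemma pinv_mult_self_eqD:
  assumes "symmetric_matrix M" and "pinv M *v (M *v x) = x"
  shows "x \<in> column_space M"
proof -
  have "x = M *v (pinv M *v x)"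
    using assms symmetric_pinv_commute by (metis matrix_vector_mul_assoc)
  then show ?thesis
    unfolding column_space_def by (metis matrix_vector_mult_in_columnspace)
qed

lemma pinv_mult_pinv: "pinv M *v (M *v (pinv M *v x)) = pinv M *v x"
  using pinv_penrose[of M] unfolding penrose_conditions_def
  by (simp add: matrix_vector_mul_assoc matrix_mul_assoc)

text \<open>The symmetric projection \<open>M ** pinv M\<close> moves across the inner product onto
  \<open>v\<close>, which it fixes because \<open>M\<close> and \<open>pinv M\<close>
  commute.\<close>

lemma wt_adjoint:
  fixes A :: "real^'n^'m"
  assumes "symmetric_matrix M" and v: "pinv M *v (M *v v) = v"
  shows "v \<bullet> (M *v ((pinv M ** transpose A ** G) *v u)) = (A *v v) \<bullet> (G *v u)"
proof -
  have "v \<bullet> (M *v ((pinv M ** transpose A ** G) *v u))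
      = v \<bullet> ((M ** pinv M) *v (transpose A *v (G *v u)))"
    by (simp only: matrix_vector_mul_assoc matrix_mul_assoc)
  also have "\<dots> = ((M ** pinv M) *v v) \<bullet> (transpose A *v (G *v u))"
    using pinv_penrose[of M] inner_matrix_vector
    unfolding penrose_conditions_def symmetric_matrix_def by metis
  also have "(M ** pinv M) *v v = v"
    using assms symmetric_pinv_commute by (metis matrix_vector_mul_assoc)
  finally show ?thesis
    by (simp only: inner_matrix_vector)
qed

section \<open>Weighted orthonormality\<close>

lemma wnorm_normalize:
  assumes "pos_semidef M" and "wnorm M x \<noteq> 0"
  shows "(x /\<^sub>R wnorm M x) \<bullet> (M *v (x /\<^sub>R wnorm M x)) = 1"
proof -
  have "x \<bullet> (M *v x) = wnorm M x * wnorm M x"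
    using assms(1) by (simp add: wnorm_def pos_semidef_def)
  then show ?thesis
    using assms(2) by (simp add: matrix_vector_mult_scaleR field_simps)
qed

lemma wt_orthonormal_Suc:
  assumes "symmetric_matrix M" and "wt_orthonormal M k w"
    and "w (Suc k) \<bullet> (M *v w (Suc k)) = 1"
    and "\<And>j. j \<in> {1..k} \<Longrightarrow> w (Suc k) \<bullet> (M *v w j) = 0"
  shows "wt_orthonormal M (Suc k) w"
proof -
  have "w j \<bullet> (M *v w (Suc k)) = 0" if "j \<in> {1..k}" for j
    using assms(1,4) that by (metis symmetric_matrix_inner)
  with assms(2-4) show ?thesis
    by (auto simp: wt_orthonormal_def le_Suc_eq)
qed

lemma wt_orthonormal_inj_on:
  assumes "wt_orthonormal M k w"
  shows "inj_on w {1..k}"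
  using assms unfolding wt_orthonormal_def inj_on_def by (metis zero_neq_one)

text \<open>The vectors \<open>M\<close>-orthogonal to \<open>w i\<close> form a subspace containing
  all the other \<open>w j\<close>. If \<open>w i\<close> lay in their span, its weighted square
  would be 0 instead of 1.\<close>

lemma wt_orthonormal_independent:
  assumes "wt_orthonormal M k w"
  shows "independent (w ` {1..k})"
proof
  assume "dependent (w ` {1..k})"
  then obtain i where i: "i \<in> {1..k}" and mem: "w i \<in> span (w ` {1..k} - {w i})"
    unfolding dependent_def by auto
  have "subspace {x. x \<bullet> (M *v w i) = 0}"
    by (simp add: subspace_def inner_add_left)
  moreover have "w ` {1..k} - {w i} \<subseteq> {x. x \<bullet> (M *v w i) = 0}"
    using assms i by (auto simp: wt_orthonormal_def)
  ultimately have "w i \<bullet> (M *v w i) = 0"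
    using mem span_minimal by blast
  then show False
    using assms i by (simp add: wt_orthonormal_def)
qed

section \<open>Krylov subspaces\<close>

lemma subspace_krylov: "subspace (krylov k B c)"
  unfolding krylov_def by simp

lemma krylov_mono: "k \<le> l \<Longrightarrow> krylov k B c \<subseteq> krylov l B c"
  unfolding krylov_def by (rule span_mono) auto

lemma dim_krylov_le: "dim (krylov k B c) \<le> k"
proof -
  have eq: "{((*v) B ^^ i) c | i. i < k} = (\<lambda>i. ((*v) B ^^ i) c) ` {..<k}"
    by auto
  have "dim (krylov k B c) \<le> card ((\<lambda>i. ((*v) B ^^ i) c) ` {..<k})"
    unfolding krylov_def eq dim_span by (rule dim_le_card) (auto simp: span_superset)
  also have "\<dots> \<le> k"
    using card_image_le[of "{..<k}"] by simp
  finally show ?thesis .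
qed

text \<open>Counting dimensions reduces the basis claim to a single inclusion: the powers of
  \<open>B\<close> applied to \<open>c\<close> never have to be expressed through the
  \<open>w i\<close>.\<close>

lemma wt_orthonormal_basis_krylovI:
  assumes "wt_orthonormal M k w" and "w ` {1..k} \<subseteq> krylov k B c"
  shows "wt_orthonormal_basis M k w (krylov k B c)"
proof -
  note inj = wt_orthonormal_inj_on[OF assms(1)]
    and ind = wt_orthonormal_independent[OF assms(1)]
  have "card (w ` {1..k}) = k"
    using card_image[OF inj] by simp
  then have "krylov k B c \<subseteq> span (w ` {1..k})"
    using card_ge_dim_independent[OF assms(2) ind] dim_krylov_le by metis
  moreover have "span (w ` {1..k}) \<subseteq> krylov k B c"
    using assms(2) subspace_krylov by (rule span_minimal)
  ultimately show ?thesis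
    using assms(1) inj ind unfolding wt_orthonormal_basis_def by blast
qed

lemma funpow_mult_swap:
  fixes A :: "real^'n^'m" and Q :: "real^'m^'n"
  shows "Q *v (((*v) (A ** Q) ^^ i) c) = ((*v) (Q ** A) ^^ i) (Q *v c)"
proof (induction i)
  case (Suc i)
  then show ?case
    by (simp flip: matrix_vector_mul_assoc)
qed simp

text \<open>From Q (A Q)^i = (Q A)^i Q. It carries the u-side Krylov space to the v-side and, with
  \<open>A\<close> and \<open>Q\<close> exchanged, back again.\<close>

lemma krylov_mult_swap:
  fixes A :: "real^'n^'m" and Q :: "real^'m^'n"
  assumes "x \<in> krylov k (A ** Q) c"
  shows "Q *v x \<in> krylov k (Q ** A) (Q *v c)"
proof -
  have "(*v) Q ` krylov k (A ** Q) c
      = span ((*v) Q ` {((*v) (A ** Q) ^^ i) c | i. i < k})"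
    unfolding krylov_def by (simp add: linear_span_image)
  also have "(*v) Q ` {((*v) (A ** Q) ^^ i) c | i. i < k}
      = {((*v) (Q ** A) ^^ i) (Q *v c) | i. i < k}"
    by (auto simp: image_def funpow_mult_swap)
  finally show ?thesis
    using assms unfolding krylov_def by blast
qed

lemma krylov_step: "krylov k B (B *v c) \<subseteq> krylov (Suc k) B c"
  unfolding krylov_def
proof (rule span_mono, safe)
  fix i assume "i < k"
  then show "\<exists>j. ((*v) B ^^ i) (B *v c) = ((*v) B ^^ j) c \<and> j < Suc k"
    by (intro exI[of _ "Suc i"]) (simp add: funpow_swap1)
qed

section \<open>The gGKB process\<close>

lemma gGKB_runs_antimono: "gGKB_runs A M G b k \<Longrightarrow> i \<le> k \<Longrightarrow> gGKB_runs A M G b i"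
  by (auto simp: gGKB_runs_def)

lemma gGKB_runsD:
  assumes "gGKB_runs A M G b k" and "i \<in> {1..k}"
  shows "gGKB_alpha A M G b i \<noteq> 0" and "gGKB_beta A M G b i \<noteq> 0"
  using assms by (auto simp: gGKB_runs_def)

text \<open>Every \<open>v\<close> is a combination of its predecessor and a vector in the range of
  \<open>pinv M\<close>, where \<open>pinv M ** M\<close> acts as the identity. A vanishing \<alpha>
  only yields the zero vector, which is fixed too, so all indices are covered.\<close>

lemma gGKB_v_fixed: "pinv M *v (M *v gGKB_v A M G b i) = gGKB_v A M G b i"
proof (induction i)
  case (Suc i)
  have "pinv M *v (M *v ((pinv M ** transpose A ** G) *v x)) = (pinv M ** transpose A ** G) *v x"
    for x
    by (simp add: pinv_mult_pinv flip: matrix_vector_mul_assoc)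
  with Suc show ?case
    by (simp add: matrix_vector_mult_scaleR matrix_vector_mult_diff_distrib
        del: gGKB_alpha.simps)
qed simp

lemma gGKB_v_recurrence:
  assumes "gGKB_alpha A M G b (Suc i) \<noteq> 0"
  shows "(pinv M ** transpose A ** G) *v gGKB_u A M G b (Suc i)
    = gGKB_alpha A M G b (Suc i) *\<^sub>R gGKB_v A M G b (Suc i)
      + gGKB_beta A M G b (Suc i) *\<^sub>R gGKB_v A M G b i"
  using assms by (simp del: gGKB_alpha.simps gGKB_beta.simps gGKB_u.simps)

text \<open>The bound \<open>i \<ge> 1\<close> excludes the first vector \<open>u\<close>, which is
  the normalized \<open>b\<close> and does not come from the recurrence.\<close>

lemma gGKB_u_recurrence:
  assumes "gGKB_beta A M G b (Suc i) \<noteq> 0" and "i \<ge> 1"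
  shows "A *v gGKB_v A M G b i
    = gGKB_beta A M G b (Suc i) *\<^sub>R gGKB_u A M G b (Suc i)
      + gGKB_alpha A M G b i *\<^sub>R gGKB_u A M G b i"
  using assms by (cases i) (simp_all del: gGKB_alpha.simps gGKB_beta.simps gGKB_v.simps)

lemma gGKB_v_normalized:
  assumes "pos_semidef M" and "gGKB_alpha A M G b (Suc i) \<noteq> 0"
  shows "gGKB_v A M G b (Suc i) \<bullet> (M *v gGKB_v A M G b (Suc i)) = 1"
  using wnorm_normalize[OF assms(1)] assms(2)
  unfolding gGKB_v.simps gGKB_alpha.simps by blast

lemma gGKB_u_normalized:
  assumes "pos_semidef G" and "gGKB_beta A M G b (Suc i) \<noteq> 0"
  shows "gGKB_u A M G b (Suc i) \<bullet> (G *v gGKB_u A M G b (Suc i)) = 1"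
proof (cases i)
  case 0
  show ?thesis
    using wnorm_normalize[OF assms(1)] assms(2)
    unfolding 0 gGKB_u.simps gGKB_beta.simps by blast
next
  case (Suc j)
  show ?thesis
    using wnorm_normalize[OF assms(1)] assms(2)
    unfolding Suc gGKB_u.simps gGKB_beta.simps by blast
qed

text \<open>The order within the induction step matters: \<open>u (Suc k)\<close> is treated first,
  from both families of length \<open>k\<close>; then \<open>v (Suc k)\<close>, using the already
  extended family of \<open>u\<close>. Each time one mixed product of \<open>A *v v\<close> and
  \<open>u\<close> is evaluated by both recurrences.\<close>

lemma gGKB_orthonormal:
  assumes M: "pos_semidef M" and G: "pos_semidef G" and "gGKB_runs A M G b k"
  shows "wt_orthonormal M k (gGKB_v A M G b) \<and> wt_orthonormal G k (gGKB_u A M G b)"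
  using assms(3)
proof (induction k)
  case 0
  show ?case
    by (simp add: wt_orthonormal_def)
next
  case (Suc k)
  let ?v = "gGKB_v A M G b" and ?u = "gGKB_u A M G b"
    and ?\<alpha> = "gGKB_alpha A M G b" and ?\<beta> = "gGKB_beta A M G b"
  note simps_off [simp del] =
    gGKB_v.simps gGKB_u.simps gGKB_alpha.simps gGKB_beta.simps
  have sM: "symmetric_matrix M" and sG: "symmetric_matrix G"
    using M G by (auto simp: pos_semidef_def)
  have adj: "?v i \<bullet> (M *v ((pinv M ** transpose A ** G) *v x)) = (A *v ?v i) \<bullet> (G *v x)" for i x
    using sM gGKB_v_fixed by (rule wt_adjoint)
  have nz: "?\<alpha> i \<noteq> 0" "?\<beta> i \<noteq> 0" if "i \<in> {1..Suc k}" for i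
    using gGKB_runsD[OF Suc.prems that] .
  have ov: "wt_orthonormal M k ?v" and ou: "wt_orthonormal G k ?u"
    using Suc gGKB_runs_antimono[of A M G b "Suc k" k] by auto
  have ou': "wt_orthonormal G (Suc k) ?u"
  proof (rule wt_orthonormal_Suc[OF sG ou])
    show "?u (Suc k) \<bullet> (G *v ?u (Suc k)) = 1"
      using G nz by (intro gGKB_u_normalized) auto
    fix j assume j: "j \<in> {1..k}"
    then obtain l where l: "j = Suc l" by (cases j) auto
    \<comment> \<open>Here \<open>l < k\<close>, and for \<open>l = 0\<close> the convention that
      \<open>v\<close> starts with the zero vector gives the claim.\<close>
    have "?v k \<bullet> (M *v ?v l) = 0"
      using ov j l by (cases "l = 0") (auto simp: wt_orthonormal_def gGKB_v.simps(1))
    moreover have "?v k \<bullet> (M *v ?v j) = (if k = j then 1 else 0)"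
      using ov j by (auto simp: wt_orthonormal_def)
    \<comment> \<open>First evaluation: pass to the adjoint and expand by the recurrence for
      \<open>v\<close> at \<open>j\<close>. The second, by the recurrence for \<open>u\<close>, has
      the same term \<alpha> in the case \<open>j = k\<close>; these cancel, leaving a multiple of
      the wanted product by a nonzero \<beta>.\<close>
    ultimately have "(A *v ?v k) \<bullet> (G *v ?u j) = ?\<alpha> j * (if k = j then 1 else 0)"
      unfolding adj[symmetric] l using j nz[of j] l
      by (simp add: gGKB_v_recurrence matrix_vector_right_distrib matrix_vector_mult_scaleR
          inner_add_right)
    moreover have "(A *v ?v k) \<bullet> (G *v ?u j)
        = ?\<beta> (Suc k) * (?u (Suc k) \<bullet> (G *v ?u j)) + ?\<alpha> k * (?u k \<bullet> (G *v ?u j))"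
      using j nz[of "Suc k"] by (simp add: gGKB_u_recurrence inner_add_left)
    moreover have "?u k \<bullet> (G *v ?u j) = (if k = j then 1 else 0)"
      using ou j by (auto simp: wt_orthonormal_def)
    ultimately show "?u (Suc k) \<bullet> (G *v ?u j) = 0"
      using nz[of "Suc k"] by (auto split: if_splits)
  qed
  have "wt_orthonormal M (Suc k) ?v"
  proof (rule wt_orthonormal_Suc[OF sM ov])
    show "?v (Suc k) \<bullet> (M *v ?v (Suc k)) = 1"
      using M nz by (intro gGKB_v_normalized) auto
    fix j assume j: "j \<in> {1..k}"
    \<comment> \<open>For \<open>j = k\<close> the index \<open>Suc j\<close> reaches
      \<open>Suc k\<close>, hence the use of the extended family \<open>ou'\<close>.\<close>
    have "?u (Suc j) \<bullet> (G *v ?u (Suc k)) = (if k = j then 1 else 0)"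
      "?u j \<bullet> (G *v ?u (Suc k)) = 0"
      using ou' j by (auto simp: wt_orthonormal_def)
    then have "(A *v ?v j) \<bullet> (G *v ?u (Suc k)) = ?\<beta> (Suc j) * (if k = j then 1 else 0)"
      using j nz[of "Suc j"] by (simp add: gGKB_u_recurrence inner_add_left)
    \<comment> \<open>The same product through the adjoint. For \<open>j = k\<close> the two \<beta>
      terms agree and cancel; what remains is the wanted product times a nonzero \<alpha>.\<close>
    moreover have "(A *v ?v j) \<bullet> (G *v ?u (Suc k))
        = ?\<alpha> (Suc k) * (?v j \<bullet> (M *v ?v (Suc k))) + ?\<beta> (Suc k) * (?v j \<bullet> (M *v ?v k))"
      unfolding adj[symmetric] using nz[of "Suc k"]
      by (simp add: gGKB_v_recurrence matrix_vector_right_distrib matrix_vector_mult_scaleR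
          inner_add_right)
    moreover have "?v j \<bullet> (M *v ?v k) = (if k = j then 1 else 0)"
      using ov j by (auto simp: wt_orthonormal_def)
    ultimately have "?v j \<bullet> (M *v ?v (Suc k)) = 0"
      using nz[of "Suc k"] by (auto split: if_splits)
    then show "?v (Suc k) \<bullet> (M *v ?v j) = 0"
      using symmetric_matrix_inner[OF sM] by metis
  qed
  with ou' show ?case by blast
qed

text \<open>\<open>Q\<close> maps the u-side space into the v-side space of the same order, whereas
  \<open>A\<close> maps back at the cost of one more power. Normalization, even by zero, stays
  inside a subspace, so no assumption that the process is still running enters.\<close>

lemma gGKB_in_krylov:
  fixes A :: "real^'n^'m"
  defines "Q \<equiv> \<lambda>M G. pinv M ** transpose A ** G"
  shows "gGKB_u A M G b (Suc i) \<in> krylov (Suc i) (A ** Q M G) b \<and>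
    gGKB_v A M G b (Suc i) \<in> krylov (Suc i) (Q M G ** A) (Q M G *v b)"
proof (induction i)
  let ?Q = "Q M G"
  let ?U = "\<lambda>i. krylov i (A ** ?Q) b" and ?V = "\<lambda>i. krylov i (?Q ** A) (?Q *v b)"
  note simps_off [simp del] =
    gGKB_v.simps gGKB_u.simps gGKB_alpha.simps gGKB_beta.simps
  have v: "gGKB_v A M G b (Suc i) \<in> ?V (Suc i)"
    if "gGKB_u A M G b (Suc i) \<in> ?U (Suc i)" "gGKB_v A M G b i \<in> ?V (Suc i)" for i
    using krylov_mult_swap[OF that(1)] that(2)
    unfolding gGKB_v.simps Q_def
    by (intro subspace_scale subspace_diff subspace_krylov)
  {
    case 0
    have "b \<in> ?U (Suc 0)"
      unfolding krylov_def by (rule span_base) auto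
    then have u: "gGKB_u A M G b (Suc 0) \<in> ?U (Suc 0)"
      unfolding gGKB_u.simps by (intro subspace_scale subspace_krylov)
    moreover have "gGKB_v A M G b 0 \<in> ?V (Suc 0)"
      by (simp add: gGKB_v.simps(1) subspace_0 subspace_krylov)
    ultimately show ?case using v by blast
  next
    case (Suc i)
    \<comment> \<open>Applying \<open>A\<close> turns the starting vector \<open>Q b\<close> into
      \<open>A Q b\<close>; \<open>krylov_step\<close> then absorbs the extra factor
      \<open>A Q\<close> by raising the order by one.\<close>
    have "A *v gGKB_v A M G b (Suc i) \<in> krylov (Suc i) (A ** ?Q) (A *v (?Q *v b))"
      using Suc by (intro krylov_mult_swap) auto
    then have "A *v gGKB_v A M G b (Suc i) \<in> ?U (Suc (Suc i))"
      using krylov_step[of "Suc i" "A ** ?Q" b] by (auto simp: matrix_vector_mul_assoc)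
    moreover have "gGKB_u A M G b (Suc i) \<in> ?U (Suc (Suc i))"
      "gGKB_v A M G b (Suc i) \<in> ?V (Suc (Suc i))"
      using Suc krylov_mono[of "Suc i" "Suc (Suc i)"] by auto
    ultimately have "gGKB_u A M G b (Suc (Suc i)) \<in> ?U (Suc (Suc i))"
      unfolding gGKB_u.simps by (intro subspace_scale subspace_diff subspace_krylov)
    then show ?case
      using v \<open>gGKB_v A M G b (Suc i) \<in> ?V (Suc (Suc i))\<close> by blast
  }
qed

theorem proposition4p1:
  fixes A :: "real^'n^'m" and M :: "real^'n^'n" and G :: "real^'m^'m"
    and b :: "real^'m" and k :: nat
  assumes "pos_semidef M" and "pos_def G" and "b \<noteq> 0"
    and "k \<ge> 1" and "gGKB_runs A M G b k"
  shows "(\<forall>i. gGKB_runs A M G b i \<longrightarrow> gGKB_v A M G b i \<in> column_space M) \<and>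
    wt_orthonormal_basis M k (gGKB_v A M G b)
      (krylov k (pinv M ** transpose A ** G ** A) ((pinv M ** transpose A ** G) *v b)) \<and>
    wt_orthonormal_basis G k (gGKB_u A M G b)
      (krylov k (A ** pinv M ** transpose A ** G) b)"
proof (intro conjI allI impI)
  let ?Q = "pinv M ** transpose A ** G"
  show "gGKB_v A M G b i \<in> column_space M" for i
    using assms(1) gGKB_v_fixed pinv_mult_self_eqD unfolding pos_semidef_def by blast
  have orth: "wt_orthonormal M k (gGKB_v A M G b)" "wt_orthonormal G k (gGKB_u A M G b)"
    using gGKB_orthonormal[OF assms(1) pos_def_imp_pos_semidef[OF assms(2)] assms(5)] by auto
  have mem: "gGKB_u A M G b i \<in> krylov k (A ** ?Q) b"
    "gGKB_v A M G b i \<in> krylov k (?Q ** A) (?Q *v b)" if "i \<in> {1..k}" for i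
  proof -
    obtain j where "i = Suc j" "Suc j \<le> k"
      using \<open>i \<in> {1..k}\<close> by (cases i) auto
    then show "gGKB_u A M G b i \<in> krylov k (A ** ?Q) b"
      "gGKB_v A M G b i \<in> krylov k (?Q ** A) (?Q *v b)"
      using gGKB_in_krylov[of A M G b j] krylov_mono[of "Suc j" k] by blast+
  qed
  show "wt_orthonormal_basis M k (gGKB_v A M G b) (krylov k (?Q ** A) (?Q *v b))"
    using orth mem by (intro wt_orthonormal_basis_krylovI) auto
  \<comment> \<open>Products associate to the left, so \<open>A\<close> has to be split off before
    the u-side matrix takes the form \<open>A ** Q\<close>; the v-side matrix already reads
    \<open>Q ** A\<close>.\<close>
  have "A ** pinv M ** transpose A ** G = A ** ?Q"
    by (simp only: matrix_mul_assoc)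
  then show "wt_orthonormal_basis G k (gGKB_u A M G b)
      (krylov k (A ** pinv M ** transpose A ** G) b)"
    using orth mem by (auto intro!: wt_orthonormal_basis_krylovI)
qed

end
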